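(* If $f(z)=z+\sum_{n=2}^{\infty}a_nz^n\in \mathcal{S}_{S,L}^*$, then $$|H_{2,2}(f^{-1})-H_{2,2}(f)|\leq\frac{1}{128}.$$ The inequality is sharp.
   Context: $\mathbb{D}=\{z\in\mathbb{C}:|z|<1\}$. $\mathcal{S}$ is the class of univalent (injective) analytic functions $f$ on $\mathbb{D}$ with expansion $f(z)=z+\sum_{n\ge 2}a_nz^n$. For analytic $g,h$ on $\mathbb{D}$, $g\prec h$ (subordination) means $g=h\circ w$ for some analytic $w:\mathbb{D}\to\mathbb{D}$ with $w(0)=0$. The class is $$\mathcal{S}_{S,L}^*=\left\{f\in\mathcal{S}:\ \frac{2zf'(z)}{f(z)-f(-z)}\prec \sqrt{1+z}\right\}$$ (principal branch of the square root). For $f\in\mathcal{S}$, the inverse function near $0$ is $f^{-1}(w)=w+A_2w^2+A_3w^3+A_4w^4+\cdots$. Set $H_{2,2}(f):=a_2a_4-a_3^2$ and $H_{2,2}(f^{-1}):=A_2A_4-A_3^2$. "Sharp" means that equality is attained by some function in the class. *)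

theory Defs
  imports "HOL-Complex_Analysis.Complex_Analysis"
begin

abbreviation unit_disc :: "complex set" where
  "unit_disc \<equiv> ball 0 1"

definition class_S :: "(complex \<Rightarrow> complex) set" where
  "class_S = {f. f holomorphic_on unit_disc \<and> inj_on f unit_disc \<and> f 0 = 0 \<and> deriv f 0 = 1}"

definition subordinate :: "(complex \<Rightarrow> complex) \<Rightarrow> (complex \<Rightarrow> complex) \<Rightarrow> bool" where
  "subordinate g h \<longleftrightarrow>
     g holomorphic_on unit_disc \<and> h holomorphic_on unit_disc \<and>
     (\<exists>w. w holomorphic_on unit_disc \<and> w ` unit_disc \<subseteq> unit_disc \<and> w 0 = 0 \<and>
          (\<forall>z\<in>unit_disc. g z = h (w z)))"

text \<open>
  The quotient \<open>2 z f'(z) / (f(z) - f(-z))\<close> has a removable singularity at the origin, where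
  its limit is \<open>1\<close> for every \<open>f\<close> in \<open>class_S\<close>; HOL division would give \<open>0\<close> there. By
  injectivity the denominator has no other zero in the disc.
\<close>

definition sym_quotient :: "(complex \<Rightarrow> complex) \<Rightarrow> complex \<Rightarrow> complex" where
  "sym_quotient f z = (if z = 0 then 1 else 2 * z * deriv f z / (f z - f (- z)))"

definition class_SSL :: "(complex \<Rightarrow> complex) set" where
  "class_SSL = {f \<in> class_S. subordinate (sym_quotient f) (\<lambda>z. csqrt (1 + z))}"

definition taylor_coeff :: "(complex \<Rightarrow> complex) \<Rightarrow> nat \<Rightarrow> complex" where
  "taylor_coeff f n = fps_nth (fps_expansion f 0) n"

definition hankel22 :: "(complex \<Rightarrow> complex) \<Rightarrow> complex" where
  "hankel22 f = taylor_coeff f 2 * taylor_coeff f 4 - (taylor_coeff f 3)\<^sup>2"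

text \<open>
  For \<open>f\<close> in \<open>class_S\<close> this is the analytic inverse on the open set \<open>f ` unit_disc\<close>, which
  contains the origin; only its germ at the origin matters for the coefficients.
\<close>

definition disc_inverse :: "(complex \<Rightarrow> complex) \<Rightarrow> complex \<Rightarrow> complex" where
  "disc_inverse f = inv_into unit_disc f"

end

theory Submission
  imports Defs
begin

text \<open>
  Both Hankel determinants contain \<open>a\<^sub>2 a\<^sub>4 - a\<^sub>3\<^sup>2\<close>, and their difference collapses to
  \<open>a\<^sub>2\<^sup>2 (a\<^sub>2\<^sup>2 - a\<^sub>3)\<close>. If \<open>w(z) = c\<^sub>1 z + c\<^sub>2 z\<^sup>2 + \<dots>\<close> is the Schwarz function of the
  subordination, squaring the defining equation gives
  \<open>4 z\<^sup>2 f'(z)\<^sup>2 = (f(z) - f(-z))\<^sup>2 (1 + w(z))\<close>, so that \<open>a\<^sub>2 = c\<^sub>1 / 4\<close> and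
  \<open>a\<^sub>3 = c\<^sub>2 / 4 - c\<^sub>1\<^sup>2 / 16\<close>, and the difference is \<open>c\<^sub>1\<^sup>2 (c\<^sub>1\<^sup>2 - 2 c\<^sub>2) / 128\<close>. With
  \<open>|c\<^sub>2| \<le> 1 - |c\<^sub>1|\<^sup>2\<close> and \<open>x = |c\<^sub>1|\<^sup>2\<close> this is at most \<open>x (2 - x) / 128 \<le> 1 / 128\<close>.

  Equality holds for \<open>w(z) = z\<close>. The function with this \<open>w\<close> has \<open>f' = exp G \<cdot> s\<close>, where
  \<open>s(z) = \<surd>(1 + z)\<close> and \<open>G\<close> is the even function with
  \<open>f(z) - f(-z) = 2 z exp (G z)\<close>. As \<open>|arg s| < \<pi>/4\<close> and \<open>|G| \<le> 1/2 < \<pi>/4\<close>, we have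
  \<open>Re f' > 0\<close>, hence \<open>f\<close> is univalent by the Noshiro--Warschawski criterion.
\<close>

section \<open>Coefficients of the inverse function\<close>

lemma taylor_coeff_eq:
  assumes "f has_fps_expansion F"
  shows "taylor_coeff f n = fps_nth F n"
  using assms by (simp add: taylor_coeff_def fps_expansion_eqI)

lemma class_S_fps_expansion:
  assumes "f \<in> class_S"
  obtains F where "f has_fps_expansion F" "fps_nth F 0 = 0" "fps_nth F 1 = 1"
proof
  show F: "f has_fps_expansion fps_expansion f 0"
    using assms by (intro has_fps_expansion_fps_expansion[of unit_disc]) (auto simp: class_S_def)
  show "fps_nth (fps_expansion f 0) 0 = 0" "fps_nth (fps_expansion f 0) 1 = 1"
    using assms by (auto simp: fps_expansion_def class_S_def)
qed

text \<open>On the open image of the disc \<open>inv_into\<close> agrees with the holomorphic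
  inverse, so it has a power series at the origin. The one-sided relation
  \<open>G oo F = fps_X\<close> already determines the coefficients of \<open>G\<close>
  recursively.\<close>

lemma disc_inverse_has_fps_expansion:
  assumes f: "f \<in> class_S" and F: "f has_fps_expansion F"
  obtains G where "disc_inverse f has_fps_expansion G" "fps_nth G 0 = 0" "G oo F = fps_X"
proof -
  have hol: "f holomorphic_on unit_disc" and inj: "inj_on f unit_disc" and f0: "f 0 = 0"
    using f by (auto simp: class_S_def)
  obtain g where g: "g holomorphic_on f ` unit_disc" "\<And>z. z \<in> unit_disc \<Longrightarrow> g (f z) = z"
    using holomorphic_has_inverse[OF hol open_ball inj] by metis
  have inv: "disc_inverse f (f z) = z" if "z \<in> unit_disc" for z
    using that inj by (simp add: disc_inverse_def)
  have hol': "disc_inverse f holomorphic_on f ` unit_disc"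
    using g(1) by (rule holomorphic_transform) (use g(2) inv in auto)
  have "open (f ` unit_disc)"
    using open_mapping_thm3[OF hol open_ball inj] .
  moreover have "0 \<in> f ` unit_disc"
    using f0 by (metis centre_in_ball image_eqI zero_less_one)
  ultimately have G: "disc_inverse f has_fps_expansion fps_expansion (disc_inverse f) 0"
    using hol' by (intro has_fps_expansion_fps_expansion)
  have F0: "fps_nth F 0 = 0"
    using fps_nth_fps_expansion[OF F, of 0] f0 by simp
  have "\<forall>\<^sub>F z in nhds 0. z \<in> unit_disc"
    by (intro eventually_nhds_in_open) auto
  hence "\<forall>\<^sub>F z in nhds 0. z = (disc_inverse f \<circ> f) z"
    by eventually_elim (use inv in auto)
  hence "(\<lambda>z. z) has_fps_expansion (fps_expansion (disc_inverse f) 0 oo F)"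
    using has_fps_expansion_compose[OF G F F0] by (subst has_fps_expansion_cong) auto
  hence "fps_expansion (disc_inverse f) 0 oo F = fps_X"
    using fps_expansion_unique_complex has_fps_expansion_fps_X by blast
  moreover have "fps_nth (fps_expansion (disc_inverse f) 0) 0 = 0"
    using inv[of 0] f0 by (simp add: fps_expansion_def)
  ultimately show ?thesis using G that by blast
qed

lemma hankel22_inverse_diff:
  assumes f: "f \<in> class_S"
  shows "hankel22 (disc_inverse f) - hankel22 f
       = taylor_coeff f 2 ^ 4 - taylor_coeff f 2 ^ 2 * taylor_coeff f 3"
proof -
  obtain F where F: "f has_fps_expansion F" "fps_nth F 0 = 0" "fps_nth F 1 = 1"
    using class_S_fps_expansion[OF f] .
  obtain G where G: "disc_inverse f has_fps_expansion G" "fps_nth G 0 = 0" "G oo F = fps_X"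
    using disc_inverse_has_fps_expansion[OF f F(1)] .
  have e: "(\<Sum>i=0..n. fps_nth G i * fps_nth (F ^ i) n) = fps_nth fps_X n" for n
    using G(3) by (metis fps_compose_nth)
  \<comment> \<open>Comparing coefficients in \<open>G oo F = fps_X\<close> degree by degree gives
    each \<open>fps_nth G n\<close> from the earlier ones, since
    \<open>fps_nth F 1 = 1\<close>.\<close>
  note S = numeral_eq_Suc fps_mult_nth power_Suc
  have 1: "fps_nth G 1 = 1"
    using e[of 1] F G(2) by simp
  have 2: "fps_nth G 2 = - fps_nth F 2"
    using e[of 2] F G(2) 1 by (simp add: S eq_neg_iff_add_eq_0 add.commute)
  have 3: "fps_nth G 3 = 2 * fps_nth F 2 ^ 2 - fps_nth F 3"
    using e[of 3] F G(2) 1 2 by (simp add: S) algebra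
  have 4: "fps_nth G 4 = 5 * fps_nth F 2 * fps_nth F 3 - 5 * fps_nth F 2 ^ 3 - fps_nth F 4"
    using e[of 4] F G(2) 1 2 3 by (simp add: S) algebra
  show ?thesis
    unfolding hankel22_def taylor_coeff_eq[OF F(1)] taylor_coeff_eq[OF G(1)] 2 3 4
    by algebra
qed

section \<open>Coefficients in terms of the Schwarz function\<close>

lemma SSL_coeffs:
  assumes f: "f \<in> class_S"
    and w: "w holomorphic_on unit_disc" "w ` unit_disc \<subseteq> unit_disc" "w 0 = 0"
    and eq: "\<forall>z\<in>unit_disc. sym_quotient f z = csqrt (1 + w z)"
  shows "taylor_coeff f 2 = taylor_coeff w 1 / 4"
    and "taylor_coeff f 3 = taylor_coeff w 2 / 4 - taylor_coeff w 1 ^ 2 / 16"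
proof -
  obtain F where F: "f has_fps_expansion F" "fps_nth F 0 = 0" "fps_nth F 1 = 1"
    using class_S_fps_expansion[OF f] .
  define W where "W = fps_expansion w 0"
  have W: "w has_fps_expansion W"
    unfolding W_def using w by (intro has_fps_expansion_fps_expansion[of unit_disc]) auto
  have W0: "fps_nth W 0 = 0"
    using fps_nth_fps_expansion[OF W, of 0] w(3) by simp
  have sq: "(2 * z * deriv f z) ^ 2 = (f z - f (- z)) ^ 2 * (1 + w z)" if z: "z \<in> unit_disc" for z
  proof (cases "z = 0")
    case False
    have "f z \<noteq> f (- z)"
      using f z False inj_onD[of f unit_disc z "- z"] by (auto simp: class_S_def)
    moreover have "(2 * z * deriv f z / (f z - f (- z))) ^ 2 = 1 + w z"
      using bspec[OF eq z] False by (simp add: sym_quotient_def)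
    ultimately show ?thesis
      by (simp add: power_divide divide_eq_eq mult.commute)
  qed simp
  have m: "(\<lambda>z::complex. - z) has_fps_expansion - fps_X"
    by (intro fps_expansion_intros)
  have Fm: "(\<lambda>z. f (- z)) has_fps_expansion (F oo - fps_X)"
    using has_fps_expansion_compose[OF F(1) m] by (simp add: o_def)
  have L: "(\<lambda>z. (2 * z * deriv f z) * (2 * z * deriv f z))
      has_fps_expansion (2 * fps_X * fps_deriv F) * (2 * fps_X * fps_deriv F)"
    by (intro fps_expansion_intros has_fps_expansion_numeral F)
  have R: "(\<lambda>z. ((f z - f (- z)) * (f z - f (- z))) * (1 + w z))
      has_fps_expansion ((F - (F oo - fps_X)) * (F - (F oo - fps_X))) * (1 + W)"
    by (intro fps_expansion_intros has_fps_expansion_1 F Fm W)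
  have "\<forall>\<^sub>F z in nhds 0. z \<in> unit_disc"
    by (intro eventually_nhds_in_open) auto
  hence "\<forall>\<^sub>F z in nhds 0. (2 * z * deriv f z) * (2 * z * deriv f z)
           = ((f z - f (- z)) * (f z - f (- z))) * (1 + w z)"
    by eventually_elim (use sq in \<open>simp add: power2_eq_square\<close>)
  hence "(\<lambda>z. (2 * z * deriv f z) * (2 * z * deriv f z))
      has_fps_expansion ((F - (F oo - fps_X)) * (F - (F oo - fps_X))) * (1 + W)"
    using R by (subst has_fps_expansion_cong) auto
  hence fps: "(2 * fps_X * fps_deriv F) * (2 * fps_X * fps_deriv F)
      = ((F - (F oo - fps_X)) * (F - (F oo - fps_X))) * (1 + W)"
    using fps_expansion_unique_complex L by blast
  have D: "F - (F oo - fps_X) = Abs_fps (\<lambda>n. (1 - (- 1) ^ n) * fps_nth F n)"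
    by (auto simp: fps_eq_iff fps_compose_uminus' algebra_simps)
  have E: "2 * fps_X * fps_deriv F = Abs_fps (\<lambda>n. 2 * of_nat n * fps_nth F n)"
    by (auto simp: fps_eq_iff mult.assoc numeral_fps_const)
  \<comment> \<open>Both squared series start with \<open>4 * z^2\<close>, so the first informative
    coefficients are those of \<open>z^3\<close>, giving \<open>a\<^sub>2\<close>, and of
    \<open>z^4\<close>, giving \<open>a\<^sub>3\<close>.\<close>
  note fps' = fps[unfolded D E]
  have 1: "fps_nth F 2 = fps_nth W 1 / 4"
    using arg_cong[OF fps', of "\<lambda>A. fps_nth A 3"] F W0
    by (simp add: numeral_eq_Suc fps_mult_nth mult.commute)
  have "16 * fps_nth F 3 + 16 * fps_nth F 2 ^ 2 = 4 * fps_nth W 2"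
    using arg_cong[OF fps', of "\<lambda>A. fps_nth A 4"] F W0 1
    by (simp add: numeral_eq_Suc fps_mult_nth algebra_simps)
  hence 2: "fps_nth F 3 = fps_nth W 2 / 4 - fps_nth W 1 ^ 2 / 16"
    unfolding 1 by (simp add: field_simps power2_eq_square)
  show "taylor_coeff f 2 = taylor_coeff w 1 / 4"
    and "taylor_coeff f 3 = taylor_coeff w 2 / 4 - taylor_coeff w 1 ^ 2 / 16"
    using 1 2 by (simp_all add: taylor_coeff_eq[OF F(1)] taylor_coeff_eq[OF W])
qed

lemma SSL_hankel22_inverse_diff:
  assumes f: "f \<in> class_S"
    and w: "w holomorphic_on unit_disc" "w ` unit_disc \<subseteq> unit_disc" "w 0 = 0"
    and eq: "\<forall>z\<in>unit_disc. sym_quotient f z = csqrt (1 + w z)"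
  shows "hankel22 (disc_inverse f) - hankel22 f
       = taylor_coeff w 1 ^ 2 * (taylor_coeff w 1 ^ 2 - 2 * taylor_coeff w 2) / 128"
  unfolding hankel22_inverse_diff[OF f] SSL_coeffs[OF assms]
  by (simp add: field_simps power2_eq_square power4_eq_xxxx)

section \<open>Coefficient bounds for Schwarz functions\<close>

text \<open>This is the Schwarz-Pick inequality at the origin for \<open>v\<close>, where
  \<open>w z = z * v z\<close>: the two coefficients of \<open>w\<close> are \<open>v 0\<close> and
  \<open>deriv v 0\<close>.\<close>

lemma Schwarz_second_coeff:
  assumes w: "w holomorphic_on unit_disc" "w ` unit_disc \<subseteq> unit_disc" "w 0 = 0"
  shows "cmod (taylor_coeff w 1) \<le> 1"
    and "cmod (taylor_coeff w 2) \<le> 1 - cmod (taylor_coeff w 1) ^ 2"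
proof -
  have lt: "cmod (w z) < 1" if "cmod z < 1" for z
    using that w(2) by (auto simp: image_subset_iff)
  have schwarz:
    "\<And>z. cmod z < 1 \<Longrightarrow> cmod (w z) \<le> cmod z"
    "cmod (deriv w 0) \<le> 1"
    "(\<exists>z. cmod z < 1 \<and> z \<noteq> 0 \<and> cmod (w z) = cmod z) \<or> cmod (deriv w 0) = 1
      \<Longrightarrow> \<exists>\<alpha>. (\<forall>z. cmod z < 1 \<longrightarrow> w z = \<alpha> * z) \<and> cmod \<alpha> = 1"
    using Schwarz_Lemma'[OF w(1) w(3)] lt by auto
  obtain v where v: "v holomorphic_on unit_disc" "\<And>z. cmod z < 1 \<Longrightarrow> w z = z * v z"
      "deriv w 0 = v 0"
    using Schwarz3[OF w(1) w(3)] by blast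
  define V where "V = fps_expansion v 0"
  have V: "v has_fps_expansion V"
    unfolding V_def using v by (intro has_fps_expansion_fps_expansion[of unit_disc]) auto
  have "(\<lambda>z. z * v z) has_fps_expansion fps_X * V"
    by (intro fps_expansion_intros V)
  moreover have "\<forall>\<^sub>F z in nhds 0. z \<in> unit_disc"
    by (intro eventually_nhds_in_open) auto
  hence "\<forall>\<^sub>F z in nhds 0. w z = z * v z"
    by eventually_elim (use v(2) in auto)
  ultimately have W: "w has_fps_expansion fps_X * V"
    by (subst has_fps_expansion_cong) auto
  have c1: "taylor_coeff w 1 = v 0" and c2: "taylor_coeff w 2 = deriv v 0"
    using fps_nth_fps_expansion[OF V, of 0] fps_nth_fps_expansion[OF V, of 1]
    by (simp_all add: taylor_coeff_eq[OF W])
  show "cmod (taylor_coeff w 1) \<le> 1"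
    using schwarz(2) v(3) c1 by simp
  then consider "cmod (v 0) = 1" | "cmod (v 0) < 1"
    unfolding c1 by linarith
  then have "cmod (deriv v 0) \<le> 1 - cmod (v 0) ^ 2"
  proof cases
    \<comment> \<open>Equality in the Schwarz lemma: \<open>w\<close> is a rotation, so its second
      coefficient vanishes.\<close>
    case 1
    then obtain \<alpha> where \<alpha>: "\<And>z. cmod z < 1 \<Longrightarrow> w z = \<alpha> * z"
      using schwarz(3) v(3) by auto
    have "\<forall>\<^sub>F z in nhds 0. z \<in> unit_disc"
      by (intro eventually_nhds_in_open) auto
    hence "\<forall>\<^sub>F z in nhds 0. w z = \<alpha> * z"
      by eventually_elim (use \<alpha> in auto)
    moreover have "(\<lambda>z. \<alpha> * z) has_fps_expansion fps_const \<alpha> * fps_X"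
      by (intro fps_expansion_intros)
    ultimately have "w has_fps_expansion fps_const \<alpha> * fps_X"
      by (subst has_fps_expansion_cong) auto
    hence "taylor_coeff w 2 = 0"
      by (simp add: taylor_coeff_eq)
    thus ?thesis using c2 1 by simp
  next
    case 2
    have v_lt: "cmod (v z) < 1" if z: "cmod z < 1" for z
    proof (cases "z = 0")
      case False
      have "cmod (w z) \<noteq> cmod z"
      proof
        assume "cmod (w z) = cmod z"
        then obtain \<alpha> where \<alpha>: "\<And>z. cmod z < 1 \<Longrightarrow> w z = \<alpha> * z" "cmod \<alpha> = 1"
          using schwarz(3) z False by blast
        have "\<forall>\<^sub>F z in nhds 0. z \<in> unit_disc"
          by (intro eventually_nhds_in_open) auto
        hence "\<forall>\<^sub>F z in nhds 0. w z = \<alpha> * z"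
          by eventually_elim (use \<alpha>(1) in auto)
        hence "deriv w 0 = deriv (\<lambda>z. \<alpha> * z) 0"
          by (rule deriv_cong_ev) simp
        hence "deriv w 0 = \<alpha>" by simp
        thus False using 2 \<alpha>(2) v(3) by simp
      qed
      hence "cmod (w z) < cmod z"
        using schwarz(1)[OF z] z by force
      thus ?thesis using v(2)[OF z] False by (simp add: norm_mult)
    qed (use 2 in simp)
    \<comment> \<open>The Moebius map moves \<open>v 0\<close> to the origin, so the Schwarz lemma
      applies to \<open>M\<close>. In \<open>deriv M 0\<close> one factor
      \<open>1 - cmod (v 0) ^ 2\<close> survives in the denominator.\<close>
    define M where "M = (\<lambda>z. Moebius_function 0 (v 0) (v z))"
    have "(Moebius_function 0 (v 0) \<circ> v) holomorphic_on unit_disc"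
      using v_lt by (intro holomorphic_on_compose_gen[OF v(1) Moebius_function_holomorphic[OF 2]]) auto
    hence "M holomorphic_on unit_disc"
      by (simp add: M_def o_def)
    moreover have "M 0 = 0" by (simp add: M_def Moebius_function_eq_zero)
    moreover have "cmod (M z) < 1" if "cmod z < 1" for z
      unfolding M_def using Moebius_function_norm_lt_1[OF 2 v_lt[OF that]] .
    ultimately have M1: "cmod (deriv M 0) \<le> 1"
      using Schwarz_Lemma(2)[of M 0] by simp
    have n: "1 - cnj (v 0) * v 0 = of_real (1 - cmod (v 0) ^ 2)"
      by (simp only: of_real_diff of_real_1 complex_norm_square mult.commute)
    have p: "0 < 1 - cmod (v 0) ^ 2"
      using 2 by (simp add: power_less_one_iff abs_square_less_1)
    hence nz: "1 - cnj (v 0) * v 0 \<noteq> 0" unfolding n by (metis less_irrefl of_real_eq_0_iff)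
    have "(v has_field_derivative deriv v 0) (at 0)"
      using v(1) by (intro holomorphic_derivI[of _ unit_disc]) auto
    hence "(M has_field_derivative deriv v 0 / (1 - cnj (v 0) * v 0)) (at 0)"
      unfolding M_def Moebius_function_simple using nz
      by (auto intro!: derivative_eq_intros)
    hence "deriv M 0 = deriv v 0 / of_real (1 - cmod (v 0) ^ 2)"
      unfolding n by (rule DERIV_imp_deriv)
    hence "cmod (deriv v 0) / (1 - cmod (v 0) ^ 2) \<le> 1"
      using M1 p by (simp only: norm_divide norm_of_real abs_of_pos)
    thus ?thesis using p by (simp add: field_simps)
  qed
  thus "cmod (taylor_coeff w 2) \<le> 1 - cmod (taylor_coeff w 1) ^ 2"
    using c1 c2 by simp
qed

lemma SSL_bound:
  assumes "f \<in> class_SSL"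
  shows "cmod (hankel22 (disc_inverse f) - hankel22 f) \<le> 1 / 128"
proof -
  have f: "f \<in> class_S" using assms by (simp add: class_SSL_def)
  obtain w where w: "w holomorphic_on unit_disc" "w ` unit_disc \<subseteq> unit_disc" "w 0 = 0"
    "\<forall>z\<in>unit_disc. sym_quotient f z = csqrt (1 + w z)"
    using assms unfolding class_SSL_def subordinate_def by blast
  define b c where "b = taylor_coeff w 1" and "c = taylor_coeff w 2"
  define x where "x = cmod b ^ 2"
  have c: "cmod c \<le> 1 - x" unfolding x_def b_def c_def using Schwarz_second_coeff[OF w(1-3)] by simp
  have "cmod (b ^ 2 - 2 * c) \<le> x + 2 * (1 - x)"
    using norm_triangle_ineq4[of "b ^ 2" "2 * c"] c by (simp add: norm_power norm_mult x_def)
  hence "x * cmod (b ^ 2 - 2 * c) \<le> x * (x + 2 * (1 - x))"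
    by (intro mult_left_mono) (auto simp: x_def)
  \<comment> \<open>The bound is \<open>x * (2 - x)\<close>, that is
    \<open>1 - (x - 1)^2\<close>.\<close>
  also have "\<dots> \<le> 1" using zero_le_power2[of "x - 1"] by (simp add: power2_eq_square algebra_simps)
  finally have "cmod (b ^ 2 * (b ^ 2 - 2 * c) / 128) \<le> 1 / 128"
    by (simp add: norm_mult norm_divide norm_power x_def)
  thus ?thesis
    unfolding SSL_hankel22_inverse_diff[OF f w] b_def c_def .
qed

section \<open>A univalence criterion and the extremal function\<close>

text \<open>
  If \<open>f a = f b\<close>, then \<open>Re (f / (b - a))\<close> restricted to the segment from \<open>a\<close> to \<open>b\<close> has
  derivative \<open>Re f' > 0\<close> but equal end values.
\<close>

lemma Noshiro_Warschawski:
  assumes "convex S" and f: "\<And>z. z \<in> S \<Longrightarrow> (f has_field_derivative f' z) (at z)"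
    and pos: "\<And>z. z \<in> S \<Longrightarrow> Re (f' z) > 0"
  shows "inj_on f S"
proof (rule inj_onI, rule ccontr)
  fix a b assume a: "a \<in> S" and b: "b \<in> S" and eq: "f a = f b" and ne: "a \<noteq> b"
  define p where "p t = a + of_real t * (b - a)" for t :: real
  have pS: "p t \<in> S" if "0 \<le> t" "t \<le> 1" for t
  proof -
    have "p t = (1 - t) *\<^sub>R a + t *\<^sub>R b"
      by (simp add: p_def scaleR_conv_of_real algebra_simps)
    thus ?thesis using convexD_alt[OF \<open>convex S\<close> a b that] by simp
  qed
  define u where "u t = Re (f (p t) / (b - a))" for t
  have du: "(u has_real_derivative Re (f' (p t))) (at t)" if "0 \<le> t" "t \<le> 1" for t
  proof -
    have "(p has_vector_derivative (b - a)) (at t)"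
      unfolding p_def by (auto intro!: derivative_eq_intros simp: has_vector_derivative_def scaleR_conv_of_real)
    hence "(f \<circ> p has_vector_derivative ((b - a) * f' (p t))) (at t)"
      using f[OF pS[OF that]] by (intro field_vector_diff_chain_at)
    hence "((\<lambda>t. (f \<circ> p) t / (b - a)) has_vector_derivative ((b - a) * f' (p t) / (b - a))) (at t)"
      by (rule has_vector_derivative_divide)
    hence "((\<lambda>t. Re ((f \<circ> p) t / (b - a))) has_vector_derivative Re ((b - a) * f' (p t) / (b - a))) (at t)"
      by (rule bounded_linear.has_vector_derivative[OF bounded_linear_Re])
    thus ?thesis using ne unfolding u_def
      by (simp add: has_real_derivative_iff_has_vector_derivative)
  qed
  have "u 0 < u 1"
  proof (rule DERIV_pos_imp_increasing[of 0 1])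
    fix t :: real assume "0 \<le> t" "t \<le> 1"
    thus "\<exists>y. (u has_real_derivative y) (at t) \<and> 0 < y"
      using du pos pS by blast
  qed simp
  thus False using eq by (simp add: u_def p_def)
qed

text \<open>
  Differentiating \<open>f(z) - f(-z) = 2 z exp (G z)\<close> shows that \<open>h = G'\<close> must satisfy
  \<open>2 (1 + z h(z)) = s(z) + s(-z)\<close>. The formula for \<open>h\<close> below is the solution with the
  factor \<open>z\<close> cancelled, so it has no removable singularity at the origin.
\<close>

locale extremal =
  fixes s h :: "complex \<Rightarrow> complex"
  defines "s z \<equiv> csqrt (1 + z)"
    and "h z \<equiv> (s (- z) - s z) / (2 * ((1 + s z) * (1 + s (- z))))"
begin

lemma s_square: "s z * s z = 1 + z"
  unfolding s_def by (metis power2_csqrt power2_eq_square)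

lemma one_plus_in_disc:
  assumes "z \<in> unit_disc"
  shows "Re (1 + z) > 0" "1 + z \<notin> \<real>\<^sub>\<le>\<^sub>0"
proof -
  show "Re (1 + z) > 0"
    using assms abs_Re_le_cmod[of z] by auto
  thus "1 + z \<notin> \<real>\<^sub>\<le>\<^sub>0" by (auto simp: complex_nonpos_Reals_iff)
qed

lemma s_holomorphic: "s holomorphic_on unit_disc"
  unfolding s_def by (intro holomorphic_intros one_plus_in_disc) auto

text \<open>The square of \<open>s z\<close> has real part \<open>Re (s z)^2 - Im (s z)^2\<close>,
  which is positive on the disc; the principal branch fixes the sign of
  \<open>Re (s z)\<close>.\<close>

lemma s_sector:
  assumes "z \<in> unit_disc"
  shows "\<bar>Im (s z)\<bar> < Re (s z)"
proof -
  have "Re (s z * s z) > 0"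
    unfolding s_square using one_plus_in_disc[OF assms] by simp
  hence "\<bar>Im (s z)\<bar> ^ 2 < Re (s z) ^ 2"
    by (simp add: power2_eq_square)
  moreover have "Re (s z) \<ge> 0"
    unfolding s_def using csqrt_principal[of "1 + z"] by auto
  ultimately show ?thesis by (rule power2_less_imp_less)
qed

lemma one_plus_s:
  assumes "z \<in> unit_disc"
  shows "1 + cmod (s z) ^ 2 \<le> cmod (1 + s z) ^ 2" "1 + s z \<noteq> 0"
proof -
  have "Re (s z) > 0" using s_sector[OF assms] by linarith
  thus "1 + cmod (s z) ^ 2 \<le> cmod (1 + s z) ^ 2"
    unfolding cmod_power2 by (simp add: power2_eq_square algebra_simps)
  with \<open>Re (s z) > 0\<close> show "1 + s z \<noteq> 0"
    by (auto simp: complex_eq_iff)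
qed

lemma h_holomorphic: "h holomorphic_on unit_disc"
proof -
  have "(s \<circ> uminus) holomorphic_on unit_disc"
    by (intro holomorphic_on_compose_gen[OF _ s_holomorphic] holomorphic_intros) auto
  hence "(\<lambda>z. s (- z)) holomorphic_on unit_disc"
    by (simp add: o_def)
  thus ?thesis
    unfolding h_def using one_plus_s(2)
    by (intro holomorphic_intros s_holomorphic) auto
qed

lemma h_bound:
  assumes "z \<in> unit_disc"
  shows "cmod (h z) \<le> 1 / 2"
proof -
  define a b where "a = cmod (s z)" and "b = cmod (s (- z))"
  define d e where "d = cmod (1 + s z)" and "e = cmod (1 + s (- z))"
  have d: "1 + a\<^sup>2 \<le> d\<^sup>2" "d > 0" and e: "1 + b\<^sup>2 \<le> e\<^sup>2" "e > 0"
    unfolding a_def b_def d_def e_def using one_plus_s[of z] one_plus_s[of "- z"] assms by auto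
  \<comment> \<open>Cauchy-Schwarz for \<open>(a, 1)\<close> and \<open>(1, b)\<close>: the two
    sides differ by \<open>(a * b - 1)^2\<close>.\<close>
  have "(a + b)\<^sup>2 \<le> (1 + a\<^sup>2) * (1 + b\<^sup>2)"
    using zero_le_power2[of "a * b - 1"] by (simp add: power2_eq_square algebra_simps)
  also have "\<dots> \<le> d\<^sup>2 * e\<^sup>2"
    using d e by (intro mult_mono) auto
  finally have "(a + b)\<^sup>2 \<le> (d * e)\<^sup>2" by (simp add: power_mult_distrib)
  hence "a + b \<le> d * e" by (rule power2_le_imp_le) (use d e in auto)
  moreover have "cmod (s (- z) - s z) \<le> a + b"
    unfolding a_def b_def using norm_triangle_ineq4[of "s (- z)" "s z"] by simp
  ultimately have "cmod (s (- z) - s z) \<le> d * e" by simp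
  moreover have "cmod (h z) = cmod (s (- z) - s z) / (2 * (d * e))"
    by (simp add: h_def d_def e_def norm_divide norm_mult)
  ultimately show ?thesis using d(2) e(2) by (simp add: divide_le_eq)
qed

lemma h_minus: "h (- z) = - h z"
  by (simp add: h_def minus_divide_left mult_ac)

lemma h_eq:
  assumes "z \<in> unit_disc"
  shows "2 * (1 + z * h z) = s z + s (- z)"
proof -
  define x y where "x = s z" and "y = s (- z)"
  have sq: "x * x = 1 + z" "y * y = 1 - z"
    unfolding x_def y_def s_square by simp_all
  have nz: "1 + x \<noteq> 0" "1 + y \<noteq> 0"
    unfolding x_def y_def using one_plus_s(2) assms by auto
  have z: "z = x * x - 1" using sq by simp
  have y: "y * y = 2 - x * x" using sq by simp
  \<comment> \<open>With denominators cleared, the claim is a polynomial identity modulo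
    \<open>x^2 + y^2 = 2\<close>.\<close>
  have "2 * ((1 + x) * (1 + y)) + z * (y - x) = (x + y) * ((1 + x) * (1 + y))"
    using y unfolding z by algebra
  moreover have "h z = (y - x) / (2 * ((1 + x) * (1 + y)))"
    by (simp add: h_def x_def y_def)
  hence "h z * (2 * ((1 + x) * (1 + y))) = y - x"
    using nz by simp
  ultimately have "(2 * (1 + z * h z)) * ((1 + x) * (1 + y)) = (x + y) * ((1 + x) * (1 + y))"
    by algebra
  hence "2 * (1 + z * h z) = x + y"
    using nz by (simp only: mult_right_cancel no_zero_divisors simp_thms)
  thus ?thesis by (simp add: x_def y_def)
qed

text \<open>Both factors have argument below \<open>pi / 4\<close> in absolute value, so the product
  stays in the right half-plane. In real terms, \<open>\<bar>sin y\<bar> < cos y\<close> is combined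
  with \<open>s_sector\<close>.\<close>

lemma exp_s_pos:
  assumes "z \<in> unit_disc" "cmod g \<le> 1 / 2"
  shows "Re (exp g * s z) > 0"
proof -
  define y where "y = Im g"
  have "\<bar>y\<bar> \<le> 1 / 2" using assms(2) abs_Im_le_cmod[of g] by (simp add: y_def)
  hence y: "\<bar>y\<bar> < pi / 4" using pi_gt3 by linarith
  have "0 < cos (2 * y)"
    using y by (intro cos_gt_zero_pi) auto
  hence c: "\<bar>sin y\<bar> ^ 2 < cos y ^ 2"
    by (simp add: cos_double)
  have "cos y \<ge> 0" using y by (intro cos_ge_zero) auto
  with c have c: "\<bar>sin y\<bar> < cos y" by (rule power2_less_imp_less)
  have "\<bar>sin y * Im (s z)\<bar> \<le> \<bar>sin y\<bar> * Re (s z)"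
    unfolding abs_mult using s_sector[OF assms(1)] by (intro mult_left_mono) auto
  also have "\<dots> < cos y * Re (s z)"
    using c s_sector[OF assms(1)] by (intro mult_strict_right_mono) auto
  finally have "0 < cos y * Re (s z) - sin y * Im (s z)" by linarith
  hence "0 < exp (Re g) * (cos y * Re (s z) - sin y * Im (s z))" by simp
  thus ?thesis by (simp add: Re_exp Im_exp y_def algebra_simps)
qed

lemma exists_extremal:
  "\<exists>f\<in>class_S. \<forall>z\<in>unit_disc. sym_quotient f z = s z"
proof -
  obtain G0 where G0: "\<And>z. z \<in> unit_disc \<Longrightarrow> (G0 has_field_derivative h z) (at z within unit_disc)"
    using holomorphic_convex_primitive'[OF convex_ball open_ball h_holomorphic] by blast
  define G where "G z = G0 z - G0 0" for z
  have G: "(G has_field_derivative h z) (at z)" if "z \<in> unit_disc" for z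
  proof -
    have "(G0 has_field_derivative h z) (at z)"
      using G0[OF that] at_within_open[OF that open_ball] by simp
    thus ?thesis unfolding G_def by (auto intro!: derivative_eq_intros)
  qed
  have G_hol: "G holomorphic_on unit_disc"
    using G by (meson field_differentiable_def field_differentiable_at_within holomorphic_onI)
  have G_bound: "cmod (G z) \<le> 1 / 2" if z: "z \<in> unit_disc" for z
  proof -
    have "cmod (G z - G 0) \<le> 1 / 2 * cmod (z - 0)"
      by (rule field_differentiable_bound[where S = unit_disc and f' = h])
         (use z G h_bound in \<open>auto intro: has_field_derivative_at_within\<close>)
    also have "\<dots> \<le> 1 / 2" using z by simp
    finally show ?thesis by (simp add: G_def)
  qed
  \<comment> \<open>As \<open>h\<close> is odd, \<open>G (- z) - G z\<close> has derivative zero,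
    and it vanishes at the origin.\<close>
  have G_even: "G (- z) = G z" if z: "z \<in> unit_disc" for z
  proof -
    have d: "((\<lambda>z. G (- z) - G z) has_field_derivative 0) (at x within unit_disc)"
      if "x \<in> unit_disc" for x
    proof -
      have "((\<lambda>z. G (- z)) has_field_derivative (h (- x) * (- 1))) (at x)"
        using that by (intro DERIV_chain2[OF G]) (auto intro!: derivative_eq_intros)
      from DERIV_diff[OF this G[OF that]]
      show ?thesis by (simp add: h_minus has_field_derivative_at_within)
    qed
    obtain c where "\<And>x. x \<in> unit_disc \<Longrightarrow> G (- x) - G x = c"
      using has_field_derivative_zero_constant[OF convex_ball d] by blast
    from this[OF z] this[of 0] show ?thesis by simp
  qed
  have "(\<lambda>z. exp (G z) * s z) holomorphic_on unit_disc"
    by (intro holomorphic_intros G_hol s_holomorphic)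
  then obtain f0 where f0: "\<And>z. z \<in> unit_disc \<Longrightarrow>
      (f0 has_field_derivative exp (G z) * s z) (at z within unit_disc)"
    using holomorphic_convex_primitive'[OF convex_ball open_ball] by blast
  define f where "f z = f0 z - f0 0" for z
  have f: "(f has_field_derivative exp (G z) * s z) (at z)" if "z \<in> unit_disc" for z
  proof -
    have "(f0 has_field_derivative exp (G z) * s z) (at z)"
      using f0[OF that] at_within_open[OF that open_ball] by simp
    thus ?thesis unfolding f_def by (auto intro!: derivative_eq_intros)
  qed
  have df: "deriv f z = exp (G z) * s z" if "z \<in> unit_disc" for z
    using f[OF that] by (rule DERIV_imp_deriv)
  have s0: "s 0 = 1" by (simp add: s_def)
  have "f holomorphic_on unit_disc"
    using f by (meson field_differentiable_def field_differentiable_at_within holomorphic_onI)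
  moreover have "inj_on f unit_disc"
    by (rule Noshiro_Warschawski[OF convex_ball f exp_s_pos]) (use G_bound in auto)
  moreover have "f 0 = 0" by (simp add: f_def)
  moreover have "deriv f 0 = 1" using df[of 0] by (simp add: s0 G_def)
  ultimately have S: "f \<in> class_S" by (simp add: class_S_def)
  \<comment> \<open>Both sides vanish at the origin, and by \<open>G_even\<close> and
    \<open>h_eq\<close> both have derivative \<open>exp (G z) * (s z + s (- z))\<close>.\<close>
  have odd: "f z - f (- z) = 2 * z * exp (G z)" if z: "z \<in> unit_disc" for z
  proof -
    have d: "((\<lambda>z. f z - f (- z) - 2 * z * exp (G z)) has_field_derivative 0) (at x within unit_disc)"
      if x: "x \<in> unit_disc" for x
    proof -
      have "((\<lambda>z. f (- z)) has_field_derivative (exp (G (- x)) * s (- x) * (- 1))) (at x)"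
        using x by (intro DERIV_chain2[OF f]) (auto intro!: derivative_eq_intros)
      moreover have "((\<lambda>z. 2 * z * exp (G z)) has_field_derivative
          exp (G x) * (2 * (1 + x * h x))) (at x)"
        using G[OF x] by (auto intro!: derivative_eq_intros simp: algebra_simps)
      ultimately have "((\<lambda>z. f z - f (- z) - 2 * z * exp (G z)) has_field_derivative
          exp (G x) * s x - exp (G (- x)) * s (- x) * (- 1) - exp (G x) * (2 * (1 + x * h x))) (at x)"
        using f[OF x] by (intro DERIV_diff)
      thus ?thesis unfolding G_even[OF x] h_eq[OF x]
        by (simp add: algebra_simps has_field_derivative_at_within)
    qed
    obtain c where "\<And>x. x \<in> unit_disc \<Longrightarrow> f x - f (- x) - 2 * x * exp (G x) = c"
      using has_field_derivative_zero_constant[OF convex_ball d] by blast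
    from this[OF z] this[of 0] show ?thesis by simp
  qed
  have "sym_quotient f z = s z" if "z \<in> unit_disc" for z
    using df[OF that] odd[OF that] s0 by (simp add: sym_quotient_def)
  with S show ?thesis by blast
qed

end

section \<open>Sharpness\<close>

lemma SSL_sharp:
  "\<exists>f\<in>class_SSL. cmod (hankel22 (disc_inverse f) - hankel22 f) = 1 / 128"
proof -
  obtain f where f: "f \<in> class_S" and eq: "\<forall>z\<in>unit_disc. sym_quotient f z = csqrt (1 + z)"
    using extremal.exists_extremal by blast
  have id: "(\<lambda>z. z) holomorphic_on unit_disc" "(\<lambda>z. z) ` unit_disc \<subseteq> unit_disc"
    by (auto intro: holomorphic_intros)
  have csqrt_hol: "(\<lambda>z. csqrt (1 + z)) holomorphic_on unit_disc"
    using extremal.s_holomorphic .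
  \<comment> \<open>\<open>subordinate\<close> demands holomorphy of the quotient, which is
    inherited from the square root it equals on the disc.\<close>
  moreover have "sym_quotient f holomorphic_on unit_disc"
    by (rule holomorphic_transform[OF csqrt_hol]) (use eq in auto)
  ultimately have "subordinate (sym_quotient f) (\<lambda>z. csqrt (1 + z))"
    unfolding subordinate_def using id eq by (intro conjI exI[of _ "\<lambda>z. z"]) auto
  with f have "f \<in> class_SSL" by (simp add: class_SSL_def)
  \<comment> \<open>For the identity as Schwarz function the two coefficients are 1 and 0.\<close>
  moreover have "hankel22 (disc_inverse f) - hankel22 f = 1 / 128"
    using SSL_hankel22_inverse_diff[OF f id refl eq]
    by (simp add: taylor_coeff_eq[OF has_fps_expansion_fps_X])
  hence "cmod (hankel22 (disc_inverse f) - hankel22 f) = 1 / 128"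
    by (simp only:) (simp add: norm_divide)
  ultimately show ?thesis by blast
qed

theorem corollary2p13:
  "(\<forall>f\<in>class_SSL. cmod (hankel22 (disc_inverse f) - hankel22 f) \<le> 1 / 128) \<and>
   (\<exists>f\<in>class_SSL. cmod (hankel22 (disc_inverse f) - hankel22 f) = 1 / 128)"
  using SSL_bound SSL_sharp by blast

end
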